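(* If $(X,\gamma)$ is a generalized Minkowski space with strictly convex gauge $\gamma$, then $\mathrm{ft}(P)$ is a singleton for every finite non-collinear subset $P=\{p_1,\ldots,p_n\}\subseteq X$.
   Context: $X$ is a finite-dimensional real vector space. A gauge on $X$ is a function $\gamma:X\to[0,+\infty)$ such that $\gamma(x)=0$ implies $x=0$; $\gamma(\lambda x)=\lambda\gamma(x)$ for all $x\in X$, $\lambda\ge 0$; and $\gamma(x+y)\le\gamma(x)+\gamma(y)$ for all $x,y\in X$ (no symmetry is assumed). The pair $(X,\gamma)$ is called a generalized Minkowski space. The gauge $\gamma$ is strictly convex if its unit ball $\{x\in X:\gamma(x)\le1\}$ is strictly convex or, equivalently, if no line segment of positive length is a subset of the unit sphere $\{x\in X:\gamma(x)=1\}$. For a finite set $P=\{p_1,\ldots,p_n\}$ of $n\ge1$ distinct points, $\mathrm{ft}(P)$ is the set of all minimizers over $X$ of $x\mapsto\sum_{i=1}^n\gamma(p_i-x)$. $P$ is non-collinear if it is not contained in a straight line. *)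

theory Defs
  imports "HOL-Analysis.Analysis"
begin

(* The name avoids a clash with HOL-Analysis's gauge (from Henstock-Kurzweil integration). *)
definition gauge_function :: "('a::real_vector \<Rightarrow> real) \<Rightarrow> bool" where
  "gauge_function \<gamma> \<longleftrightarrow>
     (\<forall>x. 0 \<le> \<gamma> x) \<and>
     (\<forall>x. \<gamma> x = 0 \<longrightarrow> x = 0) \<and>
     (\<forall>x c. 0 \<le> c \<longrightarrow> \<gamma> (c *\<^sub>R x) = c * \<gamma> x) \<and>
     (\<forall>x y. \<gamma> (x + y) \<le> \<gamma> x + \<gamma> y)"

(* The space X is the whole type 'a, an abstract real vector space without any given norm,
   inner product or topology; finite dimension means having a finite spanning set. *)
definition generalized_minkowski_space :: "('a::real_vector \<Rightarrow> real) \<Rightarrow> bool" where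
  "generalized_minkowski_space \<gamma> \<longleftrightarrow>
     (\<exists>B::'a set. finite B \<and> span B = UNIV) \<and> gauge_function \<gamma>"

definition strictly_convex_gauge :: "('a::real_vector \<Rightarrow> real) \<Rightarrow> bool" where
  "strictly_convex_gauge \<gamma> \<longleftrightarrow>
     (\<forall>a b. a \<noteq> b \<longrightarrow> \<not> closed_segment a b \<subseteq> {x. \<gamma> x = 1})"

definition ft :: "('a::real_vector \<Rightarrow> real) \<Rightarrow> 'a set \<Rightarrow> 'a set" where
  "ft \<gamma> P = {x. \<forall>y. (\<Sum>p\<in>P. \<gamma> (p - x)) \<le> (\<Sum>p\<in>P. \<gamma> (p - y))}"

end

theory Submission imports Defs
begin

text \<open>
  A Fermat--Torricelli point minimizes \<open>F(x) = (\<Sum>p\<in>P. \<gamma> (p - x))\<close>, a convex function on \<open>X\<close>.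

  At least one minimizer exists because \<open>F\<close> is continuous and coercive. As \<open>X\<close> carries no topology,
  both properties are expressed in coordinates: a finite basis \<open>B\<close> identifies \<open>X\<close> with the
  functions \<open>c :: 'a \<Rightarrow> real\<close> supported on \<open>B\<close>, and these have the product topology, in which bounded
  closed sets are compact. The gauge is continuous in the coordinates
  (\<open>continuous_on_gauge_coordinates\<close>), so it attains a positive minimum on the coordinate
  \<open>\<ell>\<^sup>1\<close>-sphere, and by homogeneity it dominates a multiple of the \<open>\<ell>\<^sup>1\<close>-norm
  (\<open>gauge_dominates_coordinates\<close>). Hence the sublevel sets of \<open>F\<close> are compact
  (\<open>ft_nonempty\<close>).

  At most one minimizer exists because of the equality case of the triangle inequality: for a
  strictly convex gauge, \<open>\<gamma> (u + v) = \<gamma> u + \<gamma> v\<close> only if one of \<open>u\<close> and \<open>v\<close> is a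
  nonnegative multiple of the other (\<open>gauge_add_eq_imp_same_direction\<close>). If \<open>x \<noteq> y\<close> are minimizers, comparing \<open>F\<close> with
  its value at the midpoint of \<open>x\<close> and \<open>y\<close> forces this equality for \<open>u = p - x\<close>, \<open>v = p - y\<close> and
  every \<open>p \<in> P\<close>, so that every \<open>p\<close> lies on the line through \<open>x\<close> and \<open>y\<close>
  (\<open>two_ft_points_imp_collinear\<close>).
\<close>

section \<open>Gauges\<close>

lemma gauge_nonneg: "gauge_function \<gamma> \<Longrightarrow> 0 \<le> \<gamma> x"
  and gauge_eq_0D: "gauge_function \<gamma> \<Longrightarrow> \<gamma> x = 0 \<Longrightarrow> x = 0"
  and gauge_scaleR: "gauge_function \<gamma> \<Longrightarrow> 0 \<le> r \<Longrightarrow> \<gamma> (r *\<^sub>R x) = r * \<gamma> x"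
  and gauge_triangle: "gauge_function \<gamma> \<Longrightarrow> \<gamma> (x + y) \<le> \<gamma> x + \<gamma> y"
  unfolding gauge_function_def by blast+

lemma gauge_0: "gauge_function \<gamma> \<Longrightarrow> \<gamma> 0 = 0"
  using gauge_scaleR[of \<gamma> 0 0] by simp

lemma gauge_pos: "gauge_function \<gamma> \<Longrightarrow> x \<noteq> 0 \<Longrightarrow> 0 < \<gamma> x"
  using gauge_nonneg[of \<gamma> x] gauge_eq_0D[of \<gamma> x] by fastforce

lemma gauge_sum_le:
  assumes "gauge_function \<gamma>" "finite A"
  shows "\<gamma> (\<Sum>a\<in>A. f a) \<le> (\<Sum>a\<in>A. \<gamma> (f a))"
  using assms(2)
proof (induction A rule: finite_induct)
  case empty
  then show ?case using gauge_0[OF assms(1)] by simp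
next
  case (insert a A)
  then show ?case using gauge_triangle[OF assms(1), of "f a" "sum f A"] by simp
qed

text \<open>
  Without symmetry, \<open>\<gamma> (- x)\<close> is not determined by \<open>\<gamma> x\<close>; the sum of both values bounds the
  gauge on the whole line spanned by \<open>x\<close>.
\<close>

lemma gauge_scaleR_le_abs:
  assumes "gauge_function \<gamma>"
  shows "\<gamma> (r *\<^sub>R x) \<le> \<bar>r\<bar> * (\<gamma> x + \<gamma> (- x))"
proof (cases "0 \<le> r")
  case True
  then show ?thesis
    using gauge_scaleR[OF assms True, of x] gauge_nonneg[OF assms, of "- x"]
    by (simp add: distrib_left)
next
  case False
  then show ?thesis
    using gauge_scaleR[OF assms, of "- r" "- x"] gauge_nonneg[OF assms, of x]
    by (simp add: distrib_left mult_nonpos_nonneg)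
qed

section \<open>Compactness and continuity in coordinates\<close>

definition coordinate_ball :: "'a set \<Rightarrow> real \<Rightarrow> ('a \<Rightarrow> real) set" where
  "coordinate_ball B R = {c. (\<forall>b. b \<notin> B \<longrightarrow> c b = 0) \<and> (\<Sum>b\<in>B. \<bar>c b\<bar>) \<le> R}"

lemma continuous_on_coordinate_norm:
  "continuous_on S (\<lambda>c :: 'a \<Rightarrow> real. \<Sum>b\<in>B. \<bar>c b\<bar>)"
  by (intro continuous_intros continuous_on_subset[OF continuous_on_product_coordinates]) auto

text \<open>The ball is a closed subset of a product of compact intervals, so Tychonoff's theorem applies.\<close>

lemma compact_coordinate_ball:
  assumes "finite B"
  shows "compact (coordinate_ball B R)"
proof -
  define Q :: "('a \<Rightarrow> real) set" where
    "Q = PiE UNIV (\<lambda>b. if b \<in> B then {- R..R} else {0})"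
  have "compactin (product_topology (\<lambda>_. euclidean) UNIV) Q"
    unfolding Q_def by (subst compactin_PiE) auto
  then have "compact Q"
    by (simp add: euclidean_product_topology)
  moreover have "closed {c :: 'a \<Rightarrow> real. (\<Sum>b\<in>B. \<bar>c b\<bar>) \<le> R}"
    by (intro closed_Collect_le continuous_on_coordinate_norm continuous_on_const)
  moreover have "coordinate_ball B R = Q \<inter> {c. (\<Sum>b\<in>B. \<bar>c b\<bar>) \<le> R}"
  proof -
    have "\<bar>c b\<bar> \<le> R" if "(\<Sum>b\<in>B. \<bar>c b\<bar>) \<le> R" "b \<in> B" for c :: "'a \<Rightarrow> real" and b
      using member_le_sum[of b B "\<lambda>b. \<bar>c b\<bar>"] assms that by simp
    then have "c b \<in> (if b \<in> B then {- R..R} else {0})"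
      if "c \<in> coordinate_ball B R" for c b
      using that unfolding coordinate_ball_def by (auto simp: abs_le_iff minus_le_iff)
    then show ?thesis
      unfolding Q_def coordinate_ball_def
      by (auto simp: PiE_iff split: if_splits)
  qed
  ultimately show ?thesis
    by (simp add: compact_Int_closed)
qed

text \<open>
  The triangle inequality makes the gauge Lipschitz with respect to the weighted
  \<open>\<ell>\<^sup>1\<close>-distance of coordinates.
\<close>

lemma continuous_on_gauge_coordinates:
  fixes \<gamma> :: "'a::real_vector \<Rightarrow> real"
  assumes g: "gauge_function \<gamma>" and B: "finite B"
  shows "continuous_on S (\<lambda>c. \<gamma> (q + (\<Sum>b\<in>B. c b *\<^sub>R b)))"
proof -
  define f where "f c = \<gamma> (q + (\<Sum>b\<in>B. c b *\<^sub>R b))" for c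
  define D where "D c d = (\<Sum>b\<in>B. \<bar>c b - d b\<bar> * (\<gamma> b + \<gamma> (- b)))" for c d
  have D_commute: "D c d = D d c" for c d
    unfolding D_def by (simp add: abs_minus_commute)
  have le: "f c - f d \<le> D c d" for c d
  proof -
    have "f c = \<gamma> ((q + (\<Sum>b\<in>B. d b *\<^sub>R b)) + (\<Sum>b\<in>B. (c b - d b) *\<^sub>R b))"
      unfolding f_def by (simp add: algebra_simps sum_subtractf)
    also have "\<dots> \<le> f d + \<gamma> (\<Sum>b\<in>B. (c b - d b) *\<^sub>R b)"
      unfolding f_def by (rule gauge_triangle[OF g])
    also have "\<gamma> (\<Sum>b\<in>B. (c b - d b) *\<^sub>R b) \<le> (\<Sum>b\<in>B. \<gamma> ((c b - d b) *\<^sub>R b))"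
      by (rule gauge_sum_le[OF g B])
    also have "\<dots> \<le> D c d"
      unfolding D_def by (intro sum_mono gauge_scaleR_le_abs[OF g])
    finally show ?thesis by simp
  qed
  have bound: "norm (f c - f d) \<le> D c d" for c d
    using le[of c d] le[of d c] D_commute[of c d] by simp
  have "(f \<longlongrightarrow> f d) (at d within S)" for d
  proof -
    have "continuous_on UNIV (\<lambda>c. D c d)"
      unfolding D_def
      by (intro continuous_intros continuous_on_product_coordinates)
    then have "((\<lambda>c. D c d) \<longlongrightarrow> D d d) (at d within S)"
      by (meson UNIV_I continuous_on_def subset_UNIV tendsto_within_subset)
    then have "((\<lambda>c. D c d) \<longlongrightarrow> 0) (at d within S)"
      by (simp add: D_def)
    then have "((\<lambda>c. f c - f d) \<longlongrightarrow> 0) (at d within S)"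
      by (rule Lim_null_comparison[OF always_eventually, rotated]) (use bound in blast)
    then show ?thesis
      by (simp add: LIM_zero_iff)
  qed
  then show ?thesis
    unfolding continuous_on_def f_def by blast
qed

text \<open>
  Independence of \<open>B\<close> keeps the gauge positive on the compact \<open>\<ell>\<^sup>1\<close>-sphere of coordinates; its
  minimum there serves as \<open>m\<close>, and homogeneity extends the bound to all coordinates.
\<close>

lemma gauge_dominates_coordinates:
  fixes \<gamma> :: "'a::real_vector \<Rightarrow> real"
  assumes g: "gauge_function \<gamma>" and B: "finite B" "independent B"
  obtains m where "0 < m" "\<And>c. m * (\<Sum>b\<in>B. \<bar>c b\<bar>) \<le> \<gamma> (\<Sum>b\<in>B. c b *\<^sub>R b)"
proof (cases "B = {}")
  case True
  then show ?thesis using that[of 1] gauge_0[OF g] by simp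
next
  case False
  define N where "N c = (\<Sum>b\<in>B. \<bar>c b\<bar>)" for c :: "'a \<Rightarrow> real"
  define f where "f c = \<gamma> (\<Sum>b\<in>B. c b *\<^sub>R b)" for c
  define S where "S = coordinate_ball B 1 \<inter> {c. N c = 1}"
  have "closed {c. N c = 1}"
    unfolding N_def by (intro closed_Collect_eq continuous_on_coordinate_norm continuous_on_const)
  then have "compact S"
    unfolding S_def by (intro compact_Int_closed compact_coordinate_ball B(1))
  moreover have "S \<noteq> {}"
  proof -
    obtain b0 where b0: "b0 \<in> B" using False by blast
    have "N (\<lambda>b. if b = b0 then 1 else 0) = 1"
      unfolding N_def using B(1) b0 by (simp add: if_distrib[of abs] cong: if_cong)
    then have "(\<lambda>b. if b = b0 then 1 else 0) \<in> S"
      unfolding S_def coordinate_ball_def using b0 by (auto simp: N_def)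
    then show ?thesis by blast
  qed
  moreover have "continuous_on S f"
    using continuous_on_gauge_coordinates[OF g B(1), of S 0] unfolding f_def by simp
  ultimately obtain c0 where c0: "c0 \<in> S" "\<And>c. c \<in> S \<Longrightarrow> f c0 \<le> f c"
    using continuous_attains_inf[of S f] by blast
  have "(\<Sum>b\<in>B. c0 b *\<^sub>R b) \<noteq> 0"
  proof
    assume "(\<Sum>b\<in>B. c0 b *\<^sub>R b) = 0"
    then have "\<forall>b\<in>B. c0 b = 0"
      using independentD[OF B(2) B(1) subset_refl] by blast
    then have "N c0 = 0" by (simp add: N_def)
    with c0(1) show False by (simp add: S_def)
  qed
  then have pos: "0 < f c0"
    unfolding f_def by (rule gauge_pos[OF g])
  have "f c0 * N c \<le> f c" for c
  proof (cases "N c = 0")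
    case True
    then show ?thesis using gauge_nonneg[OF g] by (simp add: f_def)
  next
    case False
    then have Npos: "0 < N c"
      unfolding N_def by (intro le_neq_trans sum_nonneg) auto
    \<comment> \<open>The normalized coordinates are cut off outside \<open>B\<close> to lie in the coordinate ball.\<close>
    define d where "d b = (if b \<in> B then c b / N c else 0)" for b
    have "N d = (\<Sum>b\<in>B. \<bar>c b\<bar> / N c)"
      unfolding N_def[of d] by (intro sum.cong) (use Npos in \<open>auto simp: d_def\<close>)
    also have "\<dots> = 1"
      using Npos by (simp add: sum_divide_distrib[symmetric] N_def[of c, symmetric])
    finally have "d \<in> S"
      unfolding S_def coordinate_ball_def by (auto simp: N_def d_def)
    then have "f c0 \<le> f d" by (rule c0(2))
    moreover have "(\<Sum>b\<in>B. c b *\<^sub>R b) = N c *\<^sub>R (\<Sum>b\<in>B. d b *\<^sub>R b)"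
      unfolding scaleR_sum_right by (intro sum.cong) (use Npos in \<open>auto simp: d_def\<close>)
    then have "f c = N c * f d"
      unfolding f_def using gauge_scaleR[OF g, of "N c"] Npos by simp
    ultimately show ?thesis
      using Npos by (simp add: mult.commute mult_left_mono)
  qed
  with pos show ?thesis
    using that[of "f c0"] unfolding N_def f_def by blast
qed

section \<open>Existence of a minimizer\<close>

text \<open>
  Coordinates are centred at some \<open>p0 \<in> P\<close>, that is, \<open>x = p0 - (\<Sum>b\<in>B. c b *\<^sub>R b)\<close>: then the
  summand of \<open>p0\<close> alone dominates the norm of \<open>c\<close>, and every point whose coordinates leave a
  certain ball is worse than \<open>p0\<close> itself.
\<close>

lemma ft_nonempty:
  fixes \<gamma> :: "'a::real_vector \<Rightarrow> real"
  assumes "generalized_minkowski_space \<gamma>" and P: "finite P" "P \<noteq> {}"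
  shows "ft \<gamma> P \<noteq> {}"
proof -
  from assms(1) obtain A :: "'a set" where A: "finite A" "span A = UNIV" and g: "gauge_function \<gamma>"
    unfolding generalized_minkowski_space_def by blast
  obtain B where B: "B \<subseteq> A" "independent B" "A \<subseteq> span B"
    by (rule maximal_independent_subset)
  have finB: "finite B" using B(1) A(1) finite_subset by blast
  have spanB: "span B = UNIV"
    using span_mono[OF B(3)] A(2) by (simp add: span_span top.extremum_unique)
  obtain p0 where p0: "p0 \<in> P" using P(2) by blast
  define L where "L c = (\<Sum>b\<in>B. c b *\<^sub>R b)" for c
  define F where "F x = (\<Sum>p\<in>P. \<gamma> (p - x))" for x
  obtain m where m: "0 < m" "\<And>c. m * (\<Sum>b\<in>B. \<bar>c b\<bar>) \<le> \<gamma> (L c)"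
    using gauge_dominates_coordinates[OF g finB B(2)] unfolding L_def by blast
  have F_ge: "m * (\<Sum>b\<in>B. \<bar>c b\<bar>) \<le> F (p0 - L c)" for c
  proof -
    have "\<gamma> (p0 - (p0 - L c)) \<le> F (p0 - L c)"
      unfolding F_def
      by (rule member_le_sum[OF p0 _ P(1), of "\<lambda>p. \<gamma> (p - (p0 - L c))"])
        (simp add: gauge_nonneg[OF g])
    then show ?thesis using m(2)[of c] by simp
  qed
  define K where "K = coordinate_ball B (F p0 / m)"
  have "0 \<le> F p0"
    unfolding F_def by (intro sum_nonneg gauge_nonneg[OF g])
  then have zero: "(\<lambda>_. 0) \<in> K"
    using m(1) by (simp add: K_def coordinate_ball_def)
  have "F (p0 - L c) = (\<Sum>p\<in>P. \<gamma> ((p - p0) + (\<Sum>b\<in>B. c b *\<^sub>R b)))" for c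
    unfolding F_def L_def by (intro sum.cong) (auto simp: algebra_simps)
  then have "continuous_on K (\<lambda>c. F (p0 - L c))"
    by (simp add: continuous_on_sum continuous_on_gauge_coordinates[OF g finB])
  then obtain c0 where c0: "c0 \<in> K" "\<And>c. c \<in> K \<Longrightarrow> F (p0 - L c0) \<le> F (p0 - L c)"
    using continuous_attains_inf[of K "\<lambda>c. F (p0 - L c)"] compact_coordinate_ball[OF finB] zero
    unfolding K_def by blast
  have "F (p0 - L c0) \<le> F y" for y
  proof -
    obtain u where u: "p0 - y = (\<Sum>b\<in>B. u b *\<^sub>R b)"
      using spanB span_finite[OF finB] by blast
    define c where "c b = (if b \<in> B then u b else 0)" for b
    have "L c = p0 - y" unfolding L_def c_def u by (intro sum.cong) auto
    then have y: "y = p0 - L c" by simp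
    show ?thesis
    proof (cases "c \<in> K")
      case True
      then show ?thesis using c0(2) y by simp
    next
      case False
      then have "F p0 / m < (\<Sum>b\<in>B. \<bar>c b\<bar>)"
        unfolding K_def coordinate_ball_def by (auto simp: c_def)
      then have "F p0 < m * (\<Sum>b\<in>B. \<bar>c b\<bar>)"
        using m(1) by (simp add: divide_less_eq mult.commute)
      also have "\<dots> \<le> F y" using F_ge[of c] y by simp
      finally show ?thesis using c0(2)[OF zero] by (simp add: L_def)
    qed
  qed
  then have "p0 - L c0 \<in> ft \<gamma> P"
    unfolding ft_def F_def by blast
  then show ?thesis by blast
qed

section \<open>Uniqueness of the minimizer\<close>

text \<open>
  A convex function that takes the same value at both endpoints and at one interior point of a
  segment is constant on it: if it were smaller at some point, the interior point would be a
  convex combination of that point and an endpoint, with positive weight on the former.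
\<close>

lemma gauge_segment_subset_sphere:
  fixes \<gamma> :: "'a::real_vector \<Rightarrow> real"
  assumes g: "gauge_function \<gamma>" and ends: "\<gamma> u = 1" "\<gamma> v = 1"
    and s: "0 < s" "s < 1" "\<gamma> ((1 - s) *\<^sub>R u + s *\<^sub>R v) = 1"
  shows "closed_segment u v \<subseteq> {x. \<gamma> x = 1}"
proof
  fix w assume "w \<in> closed_segment u v"
  then obtain t where t: "0 \<le> t" "t \<le> 1" and w: "w = (1 - t) *\<^sub>R u + t *\<^sub>R v"
    unfolding in_segment by blast
  have convex: "\<gamma> (a *\<^sub>R x + b *\<^sub>R y) \<le> a * \<gamma> x + b * \<gamma> y" if "0 \<le> a" "0 \<le> b" for a b x y
    using gauge_triangle[OF g, of "a *\<^sub>R x" "b *\<^sub>R y"] that by (simp add: gauge_scaleR[OF g])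
  have "\<gamma> w \<le> 1" using convex[of "1 - t" t u v] t ends w by simp
  moreover have "1 \<le> \<gamma> w"
  proof (cases "s \<le> t")
    case True
    \<comment> \<open>The interior point lies between \<open>u\<close> and \<open>w\<close>.\<close>
    have "0 < t" using True s(1) by simp
    then have eq: "(1 - s) *\<^sub>R u + s *\<^sub>R v = (1 - s / t) *\<^sub>R u + (s / t) *\<^sub>R w"
      unfolding w by (simp add: algebra_simps flip: scaleR_add_left)
    have "1 \<le> (1 - s / t) * \<gamma> u + (s / t) * \<gamma> w"
      using convex[of "1 - s / t" "s / t" u w] True \<open>0 < t\<close> s unfolding eq by simp
    then have "s / t \<le> (s / t) * \<gamma> w" using ends by simp
    then show ?thesis using \<open>0 < t\<close> s(1) by (simp add: field_simps)
  next
    case False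
    \<comment> \<open>The interior point lies between \<open>w\<close> and \<open>v\<close>.\<close>
    define r where "r = (1 - s) / (1 - t)"
    have r: "0 < r" "r \<le> 1" "r * (1 - t) = 1 - s"
      using False s by (auto simp: r_def)
    then have coeff: "r * t + (1 - r) = s" by (simp add: algebra_simps)
    have eq: "(1 - s) *\<^sub>R u + s *\<^sub>R v = r *\<^sub>R w + (1 - r) *\<^sub>R v"
    proof -
      have "r *\<^sub>R w + (1 - r) *\<^sub>R v = (r * (1 - t)) *\<^sub>R u + (r * t + (1 - r)) *\<^sub>R v"
        unfolding w by (simp only: scaleR_add_right scaleR_add_left scaleR_scaleR add.assoc)
      then show ?thesis by (simp only: r(3) coeff)
    qed
    have "1 \<le> r * \<gamma> w + (1 - r) * \<gamma> v"
      using convex[of r "1 - r" w v] r s(3) unfolding eq by simp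
    then have "r \<le> r * \<gamma> w" using ends by simp
    then show ?thesis using r(1) by simp
  qed
  ultimately show "w \<in> {x. \<gamma> x = 1}" by simp
qed

text \<open>
  Let \<open>u\<close> and \<open>v\<close> be normalized to \<open>u'\<close> and \<open>v'\<close> on the unit sphere. Equality in the triangle
  inequality puts an interior point of the segment from \<open>u'\<close> to \<open>v'\<close>, namely \<open>u + v\<close>
  normalized, on the sphere as well, so the segment must be degenerate. The conclusion is free
  of divisions in order to include the case of a zero vector.
\<close>

lemma gauge_add_eq_imp_same_direction:
  fixes \<gamma> :: "'a::real_vector \<Rightarrow> real"
  assumes g: "gauge_function \<gamma>" and sc: "strictly_convex_gauge \<gamma>"
    and eq: "\<gamma> (u + v) = \<gamma> u + \<gamma> v"
  shows "\<gamma> v *\<^sub>R u = \<gamma> u *\<^sub>R v"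
proof (cases "u = 0 \<or> v = 0")
  case True
  then show ?thesis using gauge_0[OF g] by auto
next
  case False
  define a where "a = \<gamma> u"
  define b where "b = \<gamma> v"
  have ab: "0 < a" "0 < b" using False gauge_pos[OF g] by (auto simp: a_def b_def)
  define u' where "u' = (1 / a) *\<^sub>R u"
  define v' where "v' = (1 / b) *\<^sub>R v"
  define s where "s = b / (a + b)"
  have u'v': "\<gamma> u' = 1" "\<gamma> v' = 1"
    using ab gauge_scaleR[OF g, of "1 / a" u] gauge_scaleR[OF g, of "1 / b" v]
    by (simp_all add: u'_def v'_def a_def b_def)
  have s: "0 < s" "s < 1" using ab by (simp_all add: s_def)
  have s1: "1 - s = a / (a + b)" using ab by (simp add: s_def field_simps)
  have "(1 - s) *\<^sub>R u' + s *\<^sub>R v' = (1 / (a + b)) *\<^sub>R (u + v)"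
    unfolding s1 unfolding s_def u'_def v'_def using ab by (simp add: scaleR_add_right)
  then have "\<gamma> ((1 - s) *\<^sub>R u' + s *\<^sub>R v') = 1"
    using gauge_scaleR[OF g, of "1 / (a + b)" "u + v"] ab eq by (simp add: a_def b_def)
  then have "closed_segment u' v' \<subseteq> {x. \<gamma> x = 1}"
    by (rule gauge_segment_subset_sphere[OF g u'v' s])
  then have "u' = v'"
    using sc unfolding strictly_convex_gauge_def by blast
  then have "(a * b) *\<^sub>R u' = (a * b) *\<^sub>R v'" by simp
  then have "b *\<^sub>R u = a *\<^sub>R v"
    using ab by (simp add: u'_def v'_def)
  then show ?thesis by (simp add: a_def b_def)
qed

text \<open>
  Summed over \<open>p \<in> P\<close>, the midpoint inequalities
  \<open>2 * \<gamma> (p - z) \<le> \<gamma> (p - x) + \<gamma> (p - y)\<close> add up to an equality if \<open>x\<close> and \<open>y\<close> are minimizers, so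
  each of them is an equality.
\<close>

lemma two_ft_points_imp_collinear:
  fixes \<gamma> :: "'a::real_vector \<Rightarrow> real"
  assumes g: "gauge_function \<gamma>" and sc: "strictly_convex_gauge \<gamma>" and P: "finite P"
    and x: "x \<in> ft \<gamma> P" and y: "y \<in> ft \<gamma> P" and "x \<noteq> y"
  shows "collinear P"
proof -
  define z where "z = (1 / 2) *\<^sub>R (x + y)"
  have two: "2 * \<gamma> (p - z) = \<gamma> ((p - x) + (p - y))" for p
  proof -
    have "2 *\<^sub>R z = x + y" by (simp add: z_def)
    then have "(p - x) + (p - y) = 2 *\<^sub>R (p - z)"
      by (simp add: scaleR_diff_right scaleR_2)
    then show ?thesis using gauge_scaleR[OF g, of 2 "p - z"] by simp
  qed
  have le: "2 * \<gamma> (p - z) \<le> \<gamma> (p - x) + \<gamma> (p - y)" for p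
    unfolding two by (rule gauge_triangle[OF g])
  have "(\<Sum>p\<in>P. \<gamma> (p - x)) \<le> (\<Sum>p\<in>P. \<gamma> (p - z))" "(\<Sum>p\<in>P. \<gamma> (p - y)) \<le> (\<Sum>p\<in>P. \<gamma> (p - z))"
    using x y by (auto simp: ft_def)
  then have "(\<Sum>p\<in>P. \<gamma> (p - x) + \<gamma> (p - y)) \<le> (\<Sum>p\<in>P. 2 * \<gamma> (p - z))"
    by (simp add: sum.distrib flip: sum_distrib_left)
  then have sum_eq: "(\<Sum>p\<in>P. 2 * \<gamma> (p - z)) = (\<Sum>p\<in>P. \<gamma> (p - x) + \<gamma> (p - y))"
    by (rule antisym[OF sum_mono[OF le]])
  have on_line: "\<exists>c. p - x = c *\<^sub>R (y - x)" if "p \<in> P" for p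
  proof -
    have "2 * \<gamma> (p - z) = \<gamma> (p - x) + \<gamma> (p - y)"
      using sum_mono_inv[OF sum_eq le that P] .
    then have "\<gamma> (p - y) *\<^sub>R (p - x) = \<gamma> (p - x) *\<^sub>R (p - y)"
      unfolding two by (rule gauge_add_eq_imp_same_direction[OF g sc])
    then have eq: "(\<gamma> (p - x) - \<gamma> (p - y)) *\<^sub>R (p - x) = \<gamma> (p - x) *\<^sub>R (y - x)"
      by (simp add: algebra_simps)
    show ?thesis
    proof (cases "\<gamma> (p - x) = \<gamma> (p - y)")
      case True
      then have "p - x = 0"
        using eq \<open>x \<noteq> y\<close> gauge_eq_0D[OF g, of "p - x"] by simp
      then show ?thesis by (intro exI[of _ 0]) simp
    next
      case False
      then have "p - x = (\<gamma> (p - x) / (\<gamma> (p - x) - \<gamma> (p - y))) *\<^sub>R (y - x)"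
        using arg_cong[OF eq, of "\<lambda>w. (1 / (\<gamma> (p - x) - \<gamma> (p - y))) *\<^sub>R w"] by simp
      then show ?thesis by blast
    qed
  qed
  show ?thesis
    unfolding collinear_def
  proof (intro exI[of _ "y - x"] ballI)
    fix p q assume "p \<in> P" "q \<in> P"
    then obtain c d where "p - x = c *\<^sub>R (y - x)" "q - x = d *\<^sub>R (y - x)"
      using on_line by blast
    then have "(p - x) - (q - x) = (c - d) *\<^sub>R (y - x)"
      by (simp only: scaleR_diff_left)
    then have "p - q = (c - d) *\<^sub>R (y - x)" by simp
    then show "\<exists>c. p - q = c *\<^sub>R (y - x)" by blast
  qed
qed

theorem proposition3p5:
  fixes \<gamma> :: "'a::real_vector \<Rightarrow> real" and P :: "'a set"
  assumes "generalized_minkowski_space \<gamma>"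
    and "strictly_convex_gauge \<gamma>"
    and "finite P"
    and "\<not> collinear P"
  shows "is_singleton (ft \<gamma> P)"
proof (rule is_singletonI')
  have "P \<noteq> {}" using assms(4) by auto
  then show "ft \<gamma> P \<noteq> {}" by (rule ft_nonempty[OF assms(1,3)])
next
  have "gauge_function \<gamma>"
    using assms(1) by (simp add: generalized_minkowski_space_def)
  then show "x = y" if "x \<in> ft \<gamma> P" "y \<in> ft \<gamma> P" for x y
    using two_ft_points_imp_collinear[OF _ assms(2,3) that] assms(4) by blast
qed

end
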